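(* Let $a>0$ be a fixed number. Let $\mathbf{S}_n=\mathbf{X}_1+\dots+\mathbf{X}_n$ be a random walk in $\mathbb{R}^d$ whose increments $\mathbf{X},\mathbf{X}_1,\mathbf{X}_2,\dots$ are i.i.d. and of the form $\mathbf{X}=R\mathbf{U}$, where assumptions (A1) (on $R$, with function $h$) and (A2) (on $\mathbf{U}$), both written out in the context, hold. Then $$\lim_{n\to\infty}\frac{\log(\mathbb{P}(\|\mathbf{S}_n\|_2>na))}{h(na)}=-1.$$
   Context: $\|\cdot\|_2$ is the Euclidean norm on $\mathbb{R}^d$ and $\mathbb{S}^{d-1}=\{\mathbf{x}\in\mathbb{R}^d:\|\mathbf{x}\|_2=1\}$. The limit $n\to\infty$ is along natural numbers. (A1): $R$ is a nonnegative random variable (the radius) whose tail satisfies $-\log(\mathbb{P}(R>x))\sim h(x)$ as $x\to\infty$ (i.e. the ratio tends to $1$), where $h:[0,\infty)\to\mathbb{R}$ is an increasing and concave function such that (i) $h(x)=o(x)$ and (ii) $\log(x)=o(h(x))$ as $x\to\infty$. (A2): $\mathbf{U}$ is a random vector taking values in $\mathbb{S}^{d-1}$. For every (measurable) subset $S\subset\mathbb{S}^{d-1}$ with positive Lebesgue (surface) measure, $\mathbb{P}(\mathbf{U}\in S)>0$ and $\lim_{x\to\infty}\mathbb{P}(\mathbf{U}\in S\mid R>x)=\mathbb{P}(\mathbf{U}\in S)$. Moreover $\mathbb{E}(R\mathbf{U})=\mathbf{0}$. *)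

theory Defs
  imports "HOL-Probability.Probability" "HOL-Library.Landau_Symbols"
begin

text \<open>
  Lebesgue surface measure on the unit sphere, in its usual polar-coordinate form: the surface
  measure of a Borel set \<open>S\<close> in the sphere is the dimension times the volume of the part of the
  cone over \<open>S\<close> lying in the unit ball. Here \<open>sgn x = x /\<^sub>R norm x\<close> is the radial projection.
  The measure lives on the Borel sets of the whole space and is carried by the sphere.
\<close>

definition sphere_surface :: "(real ^ 'd) measure" where
  "sphere_surface =
     scale_measure (ennreal (real CARD('d)))
       (distr (restrict_space lborel (cball 0 1 - {0})) borel sgn)"

lemma sets_sphere_surface [simp]: "sets sphere_surface = sets borel"
  by (simp add: sphere_surface_def)

lemma emeasure_sphere_surface:
  fixes S :: "(real ^ 'd) set"
  assumes "S \<in> sets borel" "S \<subseteq> sphere 0 1"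
  shows "emeasure sphere_surface S =
           ennreal (real CARD('d)) * emeasure lborel {r *\<^sub>R x | r x. 0 < r \<and> r \<le> 1 \<and> x \<in> S}"
proof -
  let ?B = "cball (0 :: real ^ 'd) 1 - {0}"
  let ?N = "restrict_space (lborel :: (real ^ 'd) measure) ?B"
  have B: "?B \<in> sets borel" by simp
  have m: "(sgn :: real ^ 'd \<Rightarrow> real ^ 'd) \<in> measurable ?N borel"
    by (auto simp: sgn_div_norm intro!: measurable_restrict_space1)
  have eq: "sgn -` S \<inter> space ?N = {r *\<^sub>R x | r x. 0 < r \<and> r \<le> 1 \<and> x \<in> S}"
  proof (intro equalityI subsetI)
    fix y assume "y \<in> sgn -` S \<inter> space ?N"
    then have "sgn y \<in> S" "0 < norm y" "norm y \<le> 1" "y = norm y *\<^sub>R sgn y"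
      by (auto simp: space_restrict_space sgn_div_norm)
    then show "y \<in> {r *\<^sub>R x | r x. 0 < r \<and> r \<le> 1 \<and> x \<in> S}" by blast
  next
    fix y assume "y \<in> {r *\<^sub>R x | r x. 0 < r \<and> r \<le> 1 \<and> x \<in> S}"
    then obtain r x where y: "y = r *\<^sub>R x" "0 < r" "r \<le> 1" "x \<in> S" by blast
    with assms(2) have "norm x = 1" by auto
    with y show "y \<in> sgn -` S \<inter> space ?N"
      by (auto simp: space_restrict_space sgn_div_norm)
  qed
  have "emeasure (distr ?N borel sgn) S = emeasure lborel (sgn -` S \<inter> space ?N)"
    using B assms(1) m
    by (simp add: emeasure_distr) (subst emeasure_restrict_space; auto simp: space_restrict_space)
  then show ?thesis by (simp only: sphere_surface_def emeasure_scale_measure eq)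
qed

end

theory Submission
  imports Defs "HOL-Real_Asymp.Real_Asymp"
begin

text \<open>
  Replacing \<open>h\<close> by \<open>h - h 0\<close> one may assume \<open>h 0 = 0\<close>, so that \<open>h x / x\<close> is nonincreasing.

  Upper bound: either some increment has norm above \<open>b = n a\<close>, or the sum of the increments
  truncated at norm \<open>b\<close> is large in one of finitely many directions \<open>v\<close>. For the latter use
  Chernoff with the parameter \<open>l = p h(b) / b\<close>, where \<open>p < 1\<close>. On \<open>norm X \<le> b\<close> monotonicity of
  \<open>h x / x\<close> gives \<open>l norm X \<le> p h(norm X)\<close>, so \<open>(exp (l (v \<bullet> X)) - 1) / l\<close> is dominated by the
  integrable variable \<open>norm X exp (p h(norm X))\<close> and its truncated mean tends to \<open>E (v \<bullet> X) = 0\<close>.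
  Hence the truncated moment generating function is \<open>1 + o(l)\<close>, and its \<open>n\<close>-th power
  is \<open>exp (o(h(b)))\<close>.

  Lower bound: one big jump and the weak law of large numbers for the other increments.
\<close>

section \<open>Concave rate functions vanishing at 0\<close>

locale concave_rate =
  fixes h :: "real \<Rightarrow> real"
  assumes h_0: "h 0 = 0"
    and h_mono: "mono_on {0..} h"
    and h_concave: "concave_on {0..} h"
    and h_sublinear: "h \<in> o[at_top](\<lambda>x. x)"
    and h_superlog: "(\<lambda>x. ln x) \<in> o[at_top](h)"
begin

lemma h_le: "0 \<le> x \<Longrightarrow> x \<le> y \<Longrightarrow> h x \<le> h y"
  using h_mono by (auto simp: mono_on_def)

lemma h_nonneg: "0 \<le> x \<Longrightarrow> 0 \<le> h x"
  using h_le[of 0 x] by (simp add: h_0)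

text \<open>Concavity on the segment from 0 to \<open>x\<close>, where \<open>h_0\<close> removes
  the endpoint term. Within the locale, concavity enters only through this inequality.\<close>

lemma h_star_shaped:
  assumes "0 \<le> t" "t \<le> 1" "0 \<le> x"
  shows "t * h x \<le> h (t * x)"
  using concave_onD[OF h_concave assms(1,2), of 0 x] assms(3) by (simp add: h_0)

lemma h_ratio_antimono:
  assumes "0 < x" "x \<le> y"
  shows "h y / y \<le> h x / x"
  using h_star_shaped[of "x / y" y] assms by (simp add: field_simps)

text \<open>Rounding a radius up to the next integer thus costs only a constant factor in
  \<open>exp (p * h x)\<close>.\<close>

lemma h_Suc_le:
  assumes "1 \<le> x"
  shows "h (x + 1) \<le> h x + h 1"
proof -
  have "h (x + 1) \<le> (x + 1) * (h x / x)"
    using h_ratio_antimono[of x "x + 1"] assms by (simp add: field_simps)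
  also have "\<dots> = h x + h x / x"
    using assms by (simp add: field_simps)
  also have "h x / x \<le> h 1"
    using h_ratio_antimono[of 1 x] assms by simp
  finally show ?thesis by simp
qed

text \<open>The form in which polynomial factors are absorbed: any fixed power of \<open>x\<close>
  is eventually below the exponential of a small multiple of \<open>h x\<close>.\<close>

lemma eventually_ln_le_h:
  assumes "0 < c"
  shows "eventually (\<lambda>x. ln x \<le> c * h x) at_top"
  using landau_o.smallD[OF h_superlog assms] eventually_ge_at_top[of 0]
  by eventually_elim (auto simp: h_nonneg)

lemma h_at_top: "filterlim h at_top at_top"
  by (rule filterlim_at_top_mono[OF ln_at_top]) (use eventually_ln_le_h[of 1] in simp)

lemma eventually_h_pos: "eventually (\<lambda>x. 0 < h x) at_top"
  using h_at_top by (auto simp: filterlim_at_top_dense)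

lemma h_ratio_tendsto_0: "((\<lambda>x. h x / x) \<longlongrightarrow> 0) at_top"
  by (rule smalloD_tendsto[OF h_sublinear])

lemma borel_measurable_h_norm [measurable]:
  "(\<lambda>x::'b::euclidean_space. h (norm x)) \<in> borel_measurable borel"
proof -
  \<comment> \<open>Monotonicity of \<open>h\<close> is known only on the nonnegative reals;
    precomposing with \<open>max 0\<close> gives a globally monotone, hence Borel, function that
    agrees with \<open>h\<close> at norms.\<close>
  have "mono (\<lambda>t. h (max 0 t))"
    by (auto simp: mono_def intro: h_le)
  then have [measurable]: "(\<lambda>t. h (max 0 t)) \<in> borel_measurable borel"
    by (rule borel_measurable_mono)
  have "(\<lambda>x::'b. h (max 0 (norm x))) \<in> borel_measurable borel"
    by measurable
  then show ?thesis by simp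
qed

end

section \<open>Tail, moments and truncated exponential moments of one increment\<close>

lemma abs_exp_minus_1_le: "\<bar>exp u - 1\<bar> \<le> \<bar>u\<bar> * exp \<bar>u\<bar>" for u :: real
proof (cases "0 \<le> u")
  case True
  have "(1 - u) * exp u \<le> exp (- u) * exp u"
    using exp_ge_add_one_self[of "- u"] by (intro mult_right_mono) auto
  then show ?thesis using True by (simp add: exp_minus field_simps)
next
  case False
  have "\<bar>exp u - 1\<bar> \<le> \<bar>u\<bar> * 1"
    using exp_ge_add_one_self[of u] False by (simp del: exp_ge_add_one_self)
  also have "\<dots> \<le> \<bar>u\<bar> * exp \<bar>u\<bar>"
    by (intro mult_left_mono) auto
  finally show ?thesis .
qed

text \<open>A discrete layer-cake bound: if \<open>t\<close> lies in \<open>(k, k + 1]\<close>, the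
  \<open>k\<close>-th term alone dominates \<open>f t\<close>. The indicators are those of tail
  events, so integrating turns the sum into one over tail probabilities; in \<open>ennreal\<close>
  no convergence has to be checked beforehand.\<close>

lemma mono_le_suminf_indicator:
  fixes f :: "real \<Rightarrow> real"
  assumes mono: "mono_on {0..} f" and nn: "0 \<le> f 0" and t: "0 \<le> t"
  shows "ennreal (f t) \<le> ennreal (f 0) + (\<Sum>k. ennreal (f (real k + 1)) * indicator {real k<..} t)"
proof (cases "t = 0")
  case False
  define k where "k = nat (\<lceil>t\<rceil> - 1)"
  have k: "real k < t" "t \<le> real k + 1"
    using False t unfolding k_def by linarith+
  have "ennreal (f t) \<le> ennreal (f (real k + 1)) * indicator {real k<..} t"
    using k mono t by (auto simp: mono_on_def intro!: ennreal_leI)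
  also have "\<dots> \<le> (\<Sum>k. ennreal (f (real k + 1)) * indicator {real k<..} t)"
    using sum_le_suminf[OF summableI, of "{k}" "\<lambda>k. ennreal (f (real k + 1)) * indicator {real k<..} t"]
    by (simp del: sum.inter_restrict sum_mult_indicator)
  finally show ?thesis
    using add_increasing[of "ennreal (f 0)"] by simp
qed simp

locale heavy_tailed_vector = prob_space M + concave_rate h
  for M :: "'w measure" and h :: "real \<Rightarrow> real" +
  fixes \<xi> :: "'w \<Rightarrow> 'v::euclidean_space"
  assumes \<xi>_rv [measurable]: "\<xi> \<in> borel_measurable M"
    and \<xi>_mean: "has_bochner_integral M \<xi> 0"
    and \<xi>_tail: "(\<lambda>x. - ln (\<P>(\<omega> in M. norm (\<xi> \<omega>) > x))) \<sim>[at_top] h"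
begin

lemma ln_tail_ratio_tendsto:
  "((\<lambda>x. - ln (\<P>(\<omega> in M. norm (\<xi> \<omega>) > x)) / h x) \<longlongrightarrow> 1) at_top"
  by (rule asymp_equivD_strong[OF \<xi>_tail])
     (rule eventually_mono[OF eventually_h_pos], simp)

lemma eventually_tail_le:
  assumes "q < 1"
  shows "eventually (\<lambda>x. \<P>(\<omega> in M. norm (\<xi> \<omega>) > x) \<le> exp (- q * h x)) at_top"
  using order_tendstoD(1)[OF ln_tail_ratio_tendsto assms] eventually_h_pos
proof eventually_elim
  case (elim x)
  let ?P = "\<P>(\<omega> in M. norm (\<xi> \<omega>) > x)"
  show ?case
  \<comment> \<open>Since \<open>ln 0 = 0\<close>, taking logarithms says nothing about a vanishing
    tail; there the bound is trivial.\<close>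
  proof (cases "?P = 0")
    case False
    then have P: "0 < ?P" using measure_nonneg[of M] by (simp add: less_le)
    from elim have "ln ?P \<le> - q * h x" by (simp add: field_simps)
    then have "exp (ln ?P) \<le> exp (- q * h x)" by (simp only: exp_le_cancel_iff)
    then show ?thesis using P by (simp only: exp_ln)
  qed simp
qed

lemma eventually_tail_ge:
  assumes "1 < q"
  shows "eventually (\<lambda>x. exp (- q * h x) \<le> \<P>(\<omega> in M. norm (\<xi> \<omega>) > x)) at_top"
  using order_tendstoD(2)[OF ln_tail_ratio_tendsto assms]
    order_tendstoD(1)[OF ln_tail_ratio_tendsto zero_less_one] eventually_h_pos
proof eventually_elim
  case (elim x)
  let ?P = "\<P>(\<omega> in M. norm (\<xi> \<omega>) > x)"
  \<comment> \<open>By the convention \<open>ln 0 = 0\<close>, a vanishing tail would make the ratio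
    0, whereas it is eventually positive.\<close>
  have "?P \<noteq> 0"
    using elim(2) by auto
  then have P: "0 < ?P" using measure_nonneg[of M] by (simp add: less_le)
  from elim have "- q * h x \<le> ln ?P" by (simp add: field_simps)
  then have "exp (- q * h x) \<le> exp (ln ?P)" by (simp only: exp_le_cancel_iff)
  then show ?case using P by (simp only: exp_ln)
qed

text \<open>The tail decays like \<open>exp (- q * h x)\<close> for every \<open>q < 1\<close>, so
  for \<open>p < q\<close> the surplus \<open>exp (- (q - p) * h x)\<close> beats every power of
  \<open>x\<close>. This variable is the dominating function for the truncated exponential
  moments.\<close>

lemma integrable_norm_exp_h:
  assumes p: "0 \<le> p" "p < 1"
  shows "integrable M (\<lambda>\<omega>. norm (\<xi> \<omega>) * exp (p * h (norm (\<xi> \<omega>))))"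
proof -
  define f where "f t = t * exp (p * h t)" for t
  define T where "T x = \<P>(\<omega> in M. norm (\<xi> \<omega>) > x)" for x
  define q where "q = (1 + p) / 2"
  have q: "p < q" "q < 1" using p by (auto simp: q_def)
  have f_mono: "mono_on {0..} f"
    using p by (auto simp: mono_on_def f_def intro!: mult_mono h_le mult_left_mono)
  have f_nn: "0 \<le> f t" if "0 \<le> t" for t
    using that by (simp add: f_def)
  \<comment> \<open>One third of the gap \<open>q - p\<close> is matched with \<open>ln x\<close>,
    so that the surplus is at most \<open>1 / x ^ 3\<close>; after the linear factor
    \<open>x + 1\<close>, at most \<open>2 * x\<close>, a summable inverse square remains.\<close>
  have "\<forall>\<^sub>F x in at_top. f (x + 1) * T x \<le> exp (p * h 1) * (2 / x\<^sup>2)"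
    using eventually_tail_le[OF q(2)] eventually_ln_le_h[of "(q - p) / 3", simplified, OF q(1)]
      eventually_ge_at_top[of 1]
  proof eventually_elim
    case (elim x)
    have "3 * ln x \<le> (q - p) * h x"
      using elim(2) q by simp
    then have "exp (- ((q - p) * h x)) \<le> exp (- (3 * ln x))"
      by simp
    also have "\<dots> = 1 / x ^ 3"
      using elim(3) exp_of_nat_mult[of 3 "ln x"] by (simp add: exp_minus field_simps)
    finally have e: "exp (- ((q - p) * h x)) \<le> 1 / x ^ 3" .
    have "f (x + 1) * T x \<le> ((2 * x) * exp (p * (h x + h 1))) * exp (- q * h x)"
      unfolding f_def T_def using elim(1,3) p h_Suc_le[of x]
      by (intro mult_mono) (auto intro!: mult_left_mono)
    also have "\<dots> = exp (p * h 1) * (2 * x) * exp (- ((q - p) * h x))"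
      by (simp add: algebra_simps flip: exp_add)
    also have "\<dots> \<le> exp (p * h 1) * (2 * x) * (1 / x ^ 3)"
      using elim(3) e by (intro mult_left_mono) auto
    also have "\<dots> = exp (p * h 1) * (2 / x\<^sup>2)"
      using elim(3) by (simp add: power2_eq_square power3_eq_cube)
    finally show ?case .
  qed
  then have "\<forall>\<^sub>F k in sequentially. f (real k + 1) * T (real k) \<le> exp (p * h 1) * (2 / (real k)\<^sup>2)"
    using filterlim_real_sequentially by (rule eventually_compose_filterlim)
  then have "\<forall>\<^sub>F k in sequentially.
      norm (f (real k + 1) * T (real k)) \<le> exp (p * h 1) * (2 / (real k)\<^sup>2)"
    by eventually_elim (simp add: f_nn T_def)
  moreover have "summable (\<lambda>k. exp (p * h 1) * (2 / (real k)\<^sup>2))"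
    using summable_mult[OF inverse_power_summable[of 2, where 'a = real], of "exp (p * h 1) * 2"]
    by (simp add: field_simps)
  ultimately have sm: "summable (\<lambda>k. f (real k + 1) * T (real k))"
    by (rule summable_comparison_test_ev)
  have "(\<integral>\<^sup>+\<omega>. ennreal (f (norm (\<xi> \<omega>))) \<partial>M) \<le>
      (\<integral>\<^sup>+\<omega>. ennreal (f 0) + (\<Sum>k. ennreal (f (real k + 1)) *
        indicator {real k<..} (norm (\<xi> \<omega>))) \<partial>M)"
    by (intro nn_integral_mono mono_le_suminf_indicator f_mono) (auto simp: f_def)
  also have "\<dots> = (\<Sum>k. \<integral>\<^sup>+\<omega>. ennreal (f (real k + 1)) *
        indicator {\<omega> \<in> space M. real k < norm (\<xi> \<omega>)} \<omega> \<partial>M)"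
    by (simp add: f_def, subst nn_integral_suminf[symmetric], measurable)
       (auto intro!: nn_integral_cong suminf_cong split: split_indicator)
  also have "\<dots> = (\<Sum>k. ennreal (f (real k + 1) * T (real k)))"
    by (intro suminf_cong, subst nn_integral_cmult_indicator)
       (auto simp: T_def emeasure_eq_measure ennreal_mult f_nn)
  also have "\<dots> < \<infinity>"
    by (subst suminf_ennreal2[OF _ sm]) (auto simp: f_nn T_def)
  finally have "(\<integral>\<^sup>+\<omega>. ennreal (f (norm (\<xi> \<omega>))) \<partial>M) < \<infinity>" .
  then show ?thesis
    by (intro integrableI_nonneg) (auto simp: f_def)
qed

text \<open>The integrand is a difference quotient at 0 of the map taking \<open>l\<close> to
  \<open>exp (l * (v \<bullet> \<xi> \<omega>))\<close>, with \<open>l = p * h b / b\<close> tending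
  to 0. Dominated convergence identifies the limit as the mean of \<open>v \<bullet> \<xi>\<close>,
  which vanishes.\<close>

lemma truncated_mgf_quotient_tendsto_0:
  assumes p: "0 < p" "p < 1" and v: "norm v \<le> 1"
  shows "((\<lambda>b. \<integral>\<omega>. (exp (p * h b / b * (v \<bullet> \<xi> \<omega>)) - 1) / (p * h b / b) *
            indicator {\<omega>. norm (\<xi> \<omega>) \<le> b} \<omega> \<partial>M) \<longlongrightarrow> 0) at_top"
proof -
  have ip: "\<bar>v \<bullet> x\<bar> \<le> norm x" for x
    using Cauchy_Schwarz_ineq2[of v x] mult_right_mono[OF v, of "norm x"] by simp
  have lim0: "((\<lambda>b. p * h b / b) \<longlongrightarrow> 0) at_top"
    using tendsto_mult_right_zero[OF h_ratio_tendsto_0, of p] by simp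
  have pos: "\<forall>\<^sub>F b in at_top. 0 < p * h b / b"
    using eventually_h_pos eventually_gt_at_top[of 0] by eventually_elim (use p in simp)
  have "((\<lambda>b. \<integral>\<omega>. (exp (p * h b / b * (v \<bullet> \<xi> \<omega>)) - 1) / (p * h b / b) *
            indicator {\<omega>. norm (\<xi> \<omega>) \<le> b} \<omega> \<partial>M) \<longlongrightarrow> (\<integral>\<omega>. v \<bullet> \<xi> \<omega> \<partial>M)) at_top"
  proof (rule integral_dominated_convergence_at_top)
    show "integrable M (\<lambda>\<omega>. norm (\<xi> \<omega>) * exp (p * h (norm (\<xi> \<omega>))))"
      using p by (intro integrable_norm_exp_h) auto
    show "AE \<omega> in M. ((\<lambda>b. (exp (p * h b / b * (v \<bullet> \<xi> \<omega>)) - 1) / (p * h b / b) *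
        indicator {\<omega>. norm (\<xi> \<omega>) \<le> b} \<omega>) \<longlongrightarrow> v \<bullet> \<xi> \<omega>) at_top"
    proof (rule AE_I2)
      fix \<omega>
      let ?y = "v \<bullet> \<xi> \<omega>"
      have "((\<lambda>l. exp (l * ?y)) has_field_derivative ?y) (at 0)"
        by (auto intro!: derivative_eq_intros)
      then have "((\<lambda>l. (exp (l * ?y) - 1) / l) \<longlongrightarrow> ?y) (at 0)"
        by (simp add: has_field_derivative_iff)
      \<comment> \<open>The punctured filter \<open>at 0\<close> requires the parameter to be
        nonzero eventually, which \<open>pos\<close> supplies.\<close>
      moreover have "filterlim (\<lambda>b. p * h b / b) (at 0) at_top"
        using lim0 pos by (auto simp: filterlim_at elim: eventually_mono)
      ultimately have "((\<lambda>b. (exp (p * h b / b * ?y) - 1) / (p * h b / b)) \<longlongrightarrow> ?y) at_top"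
        by (rule filterlim_compose)
      then show "((\<lambda>b. (exp (p * h b / b * ?y) - 1) / (p * h b / b) *
          indicator {\<omega>. norm (\<xi> \<omega>) \<le> b} \<omega>) \<longlongrightarrow> ?y) at_top"
        by (rule Lim_transform_eventually)
           (use eventually_ge_at_top[of "norm (\<xi> \<omega>)"] in eventually_elim, simp)
    qed
    show "\<forall>\<^sub>F b in at_top. AE \<omega> in M. norm ((exp (p * h b / b * (v \<bullet> \<xi> \<omega>)) - 1) / (p * h b / b) *
        indicator {\<omega>. norm (\<xi> \<omega>) \<le> b} \<omega>) \<le> norm (\<xi> \<omega>) * exp (p * h (norm (\<xi> \<omega>)))"
      using pos eventually_gt_at_top[of 0]
    proof eventually_elim
      case (elim b)
      define l where "l = p * h b / b"
      have l: "0 < l" using elim by (simp add: l_def)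
      show ?case unfolding l_def[symmetric]
      proof (rule AE_I2)
        fix \<omega>
        let ?y = "v \<bullet> \<xi> \<omega>" and ?t = "norm (\<xi> \<omega>)"
        show "norm ((exp (l * ?y) - 1) / l * indicator {\<omega>. norm (\<xi> \<omega>) \<le> b} \<omega>) \<le> ?t * exp (p * h ?t)"
        proof (cases "?t \<le> b")
          case True
          \<comment> \<open>The slope \<open>h b / b\<close> is at most \<open>h ?t / ?t\<close>
            because the truncation forces \<open>?t \<le> b\<close>. This removes the dependence on
            \<open>b\<close> from the bound.\<close>
          have lt: "l * ?t \<le> p * h ?t"
          proof (cases "?t = 0")
            case False
            then have "h b / b * ?t \<le> h ?t / ?t * ?t"
              using h_ratio_antimono[of ?t b] True by (intro mult_right_mono) auto
            then have "p * (h b / b * ?t) \<le> p * h ?t"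
              using p False by (intro mult_left_mono) auto
            then show ?thesis by (simp add: l_def)
          qed (simp add: h_0)
          have "l * \<bar>?y\<bar> \<le> l * ?t"
            using l ip by simp
          have "\<bar>exp (l * ?y) - 1\<bar> / l \<le> (\<bar>l * ?y\<bar> * exp \<bar>l * ?y\<bar>) / l"
            using l by (intro divide_right_mono abs_exp_minus_1_le) auto
          also have "\<dots> = \<bar>?y\<bar> * exp (l * \<bar>?y\<bar>)"
            using l by (simp add: abs_mult)
          also have "\<dots> \<le> ?t * exp (p * h ?t)"
            using ip lt \<open>l * \<bar>?y\<bar> \<le> l * ?t\<close> by (intro mult_mono) auto
          finally show ?thesis using True l by simp
        qed simp
      qed
    qed
  qed measurable
  moreover have "(\<integral>\<omega>. v \<bullet> \<xi> \<omega> \<partial>M) = 0"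
    using has_bochner_integral_inner_right[of v, OF \<xi>_mean]
    by (auto dest: has_bochner_integral_integral_eq)
  ultimately show ?thesis by simp
qed

text \<open>The truncated exponential moment is the probability of no truncation plus
  \<open>l\<close> times the preceding quotient, hence at most \<open>1 + \<eta> * l\<close>. The
  exponential form makes its powers explicit.\<close>

lemma eventually_truncated_mgf_le:
  assumes p: "0 < p" "p < 1" and v: "norm v \<le> 1" and "0 < \<eta>"
  shows "\<forall>\<^sub>F b in at_top. (\<integral>\<omega>. exp (p * h b / b * (v \<bullet> \<xi> \<omega>)) *
            indicator {x. norm x \<le> b} (\<xi> \<omega>) \<partial>M) \<le> exp (\<eta> * (p * h b / b))"
  using order_tendstoD(2)[OF truncated_mgf_quotient_tendsto_0[OF p v] \<open>0 < \<eta>\<close>]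
    eventually_h_pos eventually_gt_at_top[of 0]
proof eventually_elim
  case (elim b)
  define l where "l = p * h b / b"
  have l: "0 < l" using elim p by (simp add: l_def)
  have bd: "l * (v \<bullet> \<xi> \<omega>) \<le> l * b" if "norm (\<xi> \<omega>) \<le> b" for \<omega>
    using norm_cauchy_schwarz[of v "\<xi> \<omega>"] mult_right_mono[OF v, of "norm (\<xi> \<omega>)"] that l
    by (intro mult_left_mono) auto
  have int: "integrable M (\<lambda>\<omega>. exp (l * (v \<bullet> \<xi> \<omega>)) * indicator {x. norm x \<le> b} (\<xi> \<omega>))"
    by (rule integrable_const_bound[of _ "exp (l * b)"])
       (auto split: split_indicator simp: bd)
  have ind: "integrable M (\<lambda>\<omega>. indicator {x. norm x \<le> b} (\<xi> \<omega>) :: real)"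
    by (rule integrable_const_bound[of _ 1]) (auto split: split_indicator)
  have "(\<integral>\<omega>. (exp (l * (v \<bullet> \<xi> \<omega>)) - 1) / l * indicator {\<omega>. norm (\<xi> \<omega>) \<le> b} \<omega> \<partial>M)
      = (\<integral>\<omega>. (exp (l * (v \<bullet> \<xi> \<omega>)) * indicator {x. norm x \<le> b} (\<xi> \<omega>) -
              indicator {x. norm x \<le> b} (\<xi> \<omega>)) / l \<partial>M)"
    by (intro Bochner_Integration.integral_cong) (auto split: split_indicator)
  also have "\<dots> = ((\<integral>\<omega>. exp (l * (v \<bullet> \<xi> \<omega>)) * indicator {x. norm x \<le> b} (\<xi> \<omega>) \<partial>M) -
      (\<integral>\<omega>. indicator {x. norm x \<le> b} (\<xi> \<omega>) \<partial>M)) / l"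
    using int ind by simp
  finally have "((\<integral>\<omega>. exp (l * (v \<bullet> \<xi> \<omega>)) * indicator {x. norm x \<le> b} (\<xi> \<omega>) \<partial>M) -
      (\<integral>\<omega>. indicator {x. norm x \<le> b} (\<xi> \<omega>) \<partial>M)) / l < \<eta>"
    using elim(1)[folded l_def] by (simp only:)
  then have "(\<integral>\<omega>. exp (l * (v \<bullet> \<xi> \<omega>)) * indicator {x. norm x \<le> b} (\<xi> \<omega>) \<partial>M) \<le>
      (\<integral>\<omega>. indicator {x. norm x \<le> b} (\<xi> \<omega>) \<partial>M) + \<eta> * l"
    using l by (simp add: field_simps)
  also have "(\<integral>\<omega>. indicator {x. norm x \<le> b} (\<xi> \<omega>) \<partial>M) \<le> (\<integral>\<omega>. 1 \<partial>M :: real)"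
    using ind by (intro integral_mono) (auto split: split_indicator)
  also have "\<dots> = 1"
    by (simp add: prob_space)
  also have "1 + \<eta> * l \<le> exp (\<eta> * l)"
    by (rule exp_ge_add_one_self)
  finally show ?case by (simp add: l_def)
qed

end

section \<open>Random walks and the truncated Chernoff bound\<close>

locale heavy_tailed_walk = heavy_tailed_vector M h "X 1"
  for M :: "'w measure" and h :: "real \<Rightarrow> real" and X :: "nat \<Rightarrow> 'w \<Rightarrow> 'v::euclidean_space" +
  assumes X_indep: "indep_vars (\<lambda>_. borel) X {1..}"
    and X_distr: "\<And>i. 1 \<le> i \<Longrightarrow> distr M borel (X i) = distr M borel (X 1)"
begin

lemma X_rv [measurable]: "1 \<le> i \<Longrightarrow> X i \<in> borel_measurable M"
  using X_indep by (auto simp: indep_vars_def)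

lemma sum_X_rv:
  assumes "I \<subseteq> {1..}"
  shows "(\<lambda>\<omega>. \<Sum>i\<in>I. X i \<omega>) \<in> borel_measurable M"
  using assms by (intro borel_measurable_sum) (auto intro: X_rv)

lemma prob_X_eq:
  assumes "1 \<le> i" "A \<in> sets borel"
  shows "\<P>(\<omega> in M. X i \<omega> \<in> A) = \<P>(\<omega> in M. X 1 \<omega> \<in> A)"
proof -
  have "measure (distr M borel (X i)) A = measure (distr M borel (X 1)) A"
    by (simp only: X_distr[OF assms(1)])
  then show ?thesis
    using assms by (simp add: measure_distr vimage_def Int_def conj_commute)
qed

lemma expectation_X_eq:
  fixes f :: "'v \<Rightarrow> real"
  assumes "1 \<le> i" and [measurable]: "f \<in> borel_measurable borel"
  shows "(\<integral>\<omega>. f (X i \<omega>) \<partial>M) = (\<integral>\<omega>. f (X 1 \<omega>) \<partial>M)"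
proof -
  have "(\<integral>x. f x \<partial>distr M borel (X i)) = (\<integral>x. f x \<partial>distr M borel (X 1))"
    by (simp only: X_distr[OF assms(1)])
  then show ?thesis
    using assms(1) by (simp add: integral_distr)
qed

lemma truncated_Chernoff:
  assumes I: "finite I" "I \<subseteq> {1..}" and v: "norm v \<le> 1" and l: "0 \<le> l"
  shows "\<P>(\<omega> in M. v \<bullet> (\<Sum>i\<in>I. X i \<omega>) > c \<and> (\<forall>i\<in>I. norm (X i \<omega>) \<le> b)) \<le>
    exp (- l * c) * (\<integral>\<omega>. exp (l * (v \<bullet> X 1 \<omega>)) * indicator {x. norm x \<le> b} (X 1 \<omega>) \<partial>M) ^ card I"
proof -
  \<comment> \<open>Putting the indicator into each factor encodes the absence of big jumps in the
    product itself: the factors stay independent and are bounded, so all expectations exist.\<close>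
  define f where "f x = exp (l * (v \<bullet> x)) * indicator {x. norm x \<le> b} x" for x
  have [measurable]: "f \<in> borel_measurable borel"
    unfolding f_def by measurable
  have f_bound: "norm (f x) \<le> exp (l * b)" for x
    using norm_cauchy_schwarz[of v x] mult_right_mono[OF v, of "norm x"] l
    by (auto simp: f_def split: split_indicator intro!: mult_left_mono)
  have f_nn: "0 \<le> f x" for x by (simp add: f_def)
  have f_int: "integrable M (\<lambda>\<omega>. f (X i \<omega>))" if "i \<in> I" for i
  proof (rule integrable_const_bound[of _ "exp (l * b)"])
    have [measurable]: "X i \<in> borel_measurable M" using that I by (auto intro: X_rv)
    show "(\<lambda>\<omega>. f (X i \<omega>)) \<in> borel_measurable M" by measurable
  qed (use f_bound in auto)
  have ind: "indep_vars (\<lambda>_. borel) (\<lambda>i \<omega>. f (X i \<omega>)) I"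
    by (rule indep_vars_compose2[OF indep_vars_subset[OF X_indep I(2)]]) simp
  note prod_int = indep_vars_integrable[OF I(1) ind f_int]
  let ?A = "{\<omega>\<in>space M. v \<bullet> (\<Sum>i\<in>I. X i \<omega>) > c \<and> (\<forall>i\<in>I. norm (X i \<omega>) \<le> b)}"
  have "?A \<in> sets M"
  proof -
    have [measurable]: "(\<lambda>\<omega>. \<Sum>i\<in>I. X i \<omega>) \<in> borel_measurable M"
      by (rule sum_X_rv[OF I(2)])
    have [measurable]: "X i \<in> borel_measurable M" if "i \<in> I" for i
      using that I by (auto intro: X_rv)
    show ?thesis using I(1) by measurable
  qed
  then have "prob ?A = (\<integral>\<omega>. indicator ?A \<omega> \<partial>M)"
    by simp
  also have "\<dots> \<le> (\<integral>\<omega>. exp (- l * c) * (\<Prod>i\<in>I. f (X i \<omega>)) \<partial>M)"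
  proof (rule integral_mono)
    show "integrable M (indicat_real ?A)"
      using \<open>?A \<in> sets M\<close> by (simp add: emeasure_eq_measure)
    show "integrable M (\<lambda>\<omega>. exp (- l * c) * (\<Prod>i\<in>I. f (X i \<omega>)))"
      using prod_int by simp
    fix \<omega>
    show "indicat_real ?A \<omega> \<le> exp (- l * c) * (\<Prod>i\<in>I. f (X i \<omega>))"
    proof (cases "\<omega> \<in> ?A")
      case True
      then have "(\<Prod>i\<in>I. f (X i \<omega>)) = exp (\<Sum>i\<in>I. l * (v \<bullet> X i \<omega>))"
        using I(1) by (simp add: f_def exp_sum)
      also have "\<dots> = exp (l * (v \<bullet> (\<Sum>i\<in>I. X i \<omega>)))"
        by (simp add: inner_sum_right sum_distrib_left)
      finally have "exp (- l * c) * (\<Prod>i\<in>I. f (X i \<omega>)) = exp (l * (v \<bullet> (\<Sum>i\<in>I. X i \<omega>) - c))"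
        by (simp add: algebra_simps flip: exp_add)
      also have "\<dots> \<ge> 1"
        using True l by simp
      finally show ?thesis using True by simp
    qed (simp add: f_nn prod_nonneg)
  qed
  also have "\<dots> = exp (- l * c) * (\<Prod>i\<in>I. \<integral>\<omega>. f (X i \<omega>) \<partial>M)"
    using indep_vars_lebesgue_integral[OF I(1) ind f_int] by simp
  also have "(\<Prod>i\<in>I. \<integral>\<omega>. f (X i \<omega>) \<partial>M) = (\<Prod>i\<in>I. \<integral>\<omega>. f (X 1 \<omega>) \<partial>M)"
    using I(2) by (intro prod.cong expectation_X_eq) auto
  also have "\<dots> = (\<integral>\<omega>. f (X 1 \<omega>) \<partial>M) ^ card I"
    by simp
  finally show ?thesis
    by (simp add: f_def)
qed

end

section \<open>Finitely many directions and the upper bound\<close>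

text \<open>Each unit vector \<open>v\<close> lies in its own open half-space, as
  \<open>v \<bullet> v = 1\<close>; compactness of the sphere leaves finitely many. A large norm
  thus becomes a large inner product in one of finitely many directions.\<close>

lemma finite_sphere_net:
  fixes d :: real
  assumes "0 < d"
  obtains V :: "'v::euclidean_space set"
  where "finite V" "\<And>v. v \<in> V \<Longrightarrow> norm v = 1"
    "\<And>x. x \<noteq> 0 \<Longrightarrow> \<exists>v\<in>V. (1 - d) * norm x < v \<bullet> x"
proof -
  have "open {x::'v. 1 - d < v \<bullet> x}" for v
    by (rule open_halfspace_gt)
  moreover have "sphere (0::'v) 1 \<subseteq> (\<Union>v\<in>sphere 0 1. {x. 1 - d < v \<bullet> x})"
    using assms by (auto simp: norm_eq_1)
  ultimately obtain V where V: "V \<subseteq> sphere (0::'v) 1" "finite V"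
      "sphere 0 1 \<subseteq> (\<Union>v\<in>V. {x. 1 - d < v \<bullet> x})"
    using compactE_image[OF compact_sphere, of "sphere 0 1" "\<lambda>v. {x. 1 - d < v \<bullet> x}" 0 1] by metis
  show ?thesis
  proof
    fix x :: 'v
    assume "x \<noteq> 0"
    then have "sgn x \<in> sphere 0 1" by (simp add: norm_sgn)
    then obtain v where "v \<in> V" "1 - d < v \<bullet> sgn x" using V(3) by blast
    then show "\<exists>v\<in>V. (1 - d) * norm x < v \<bullet> x"
      using \<open>x \<noteq> 0\<close> by (auto simp: sgn_div_norm field_simps)
  qed (use V in auto)
qed

context heavy_tailed_walk
begin

text \<open>The bound is uniform over index sets of size \<open>n\<close>, since it depends on
  \<open>I\<close> only through its cardinality. It is applied to the full walk and to the walk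
  without its first increment.\<close>

lemma prob_sum_le:
  assumes a: "0 < a" and e: "0 < e" "e < 1"
  shows "\<forall>\<^sub>F n in sequentially. \<forall>I. finite I \<longrightarrow> I \<subseteq> {1..} \<longrightarrow> card I = n \<longrightarrow>
    \<P>(\<omega> in M. norm (\<Sum>i\<in>I. X i \<omega>) > real n * a) \<le> exp (- (1 - e) * h (real n * a))"
proof -
  \<comment> \<open>The loss \<open>e\<close> is split into quarters: the tilt \<open>p\<close>, the
    direction net and the moment bound leave the exponent \<open>p * (1 - e / 2)\<close>, at least
    \<open>1 - 3 * e / 4\<close>; the last quarter pays for the factor
    \<open>b\<^sup>2\<close>.\<close>
  define p where "p = 1 - e / 4"
  have p: "0 < p" "p < 1" using e by (auto simp: p_def)
  obtain V :: "'v set" where V: "finite V" "\<And>v. v \<in> V \<Longrightarrow> norm v = 1"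
    "\<And>x. x \<noteq> 0 \<Longrightarrow> \<exists>v\<in>V. (1 - e / 4) * norm x < v \<bullet> x"
    using finite_sphere_net[of "e / 4"] e by auto
  have na: "filterlim (\<lambda>n. real n * a) at_top sequentially"
    using a by real_asymp
  have "\<forall>\<^sub>F b in at_top. \<forall>v\<in>V. (\<integral>\<omega>. exp (p * h b / b * (v \<bullet> X 1 \<omega>)) *
            indicator {x. norm x \<le> b} (X 1 \<omega>) \<partial>M) \<le> exp (a * e / 4 * (p * h b / b))"
    \<comment> \<open>The tolerance \<open>a * e / 4\<close> is chosen so that, with
      \<open>b = n * a\<close>, the \<open>n\<close>-th power of the moment bound is
      \<open>exp (e / 4 * (l * b))\<close>.\<close>
    using V a e p by (intro eventually_ball_finite ballI eventually_truncated_mgf_le) auto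
  note ev1 = eventually_compose_filterlim[OF this na]
  have "\<forall>\<^sub>F b in at_top. \<P>(\<omega> in M. norm (X 1 \<omega>) > b) \<le> exp (- (1 - 3 * e / 4) * h b)"
    using e by (intro eventually_tail_le) auto
  note ev2 = eventually_compose_filterlim[OF this na]
  have "\<forall>\<^sub>F b in at_top. ln b \<le> e / 8 * h b"
    using e by (intro eventually_ln_le_h) auto
  note ev3 = eventually_compose_filterlim[OF this na]
  \<comment> \<open>The union bound has \<open>n + card V\<close> terms; they are counted crudely by
    the square of the threshold.\<close>
  have ev4: "\<forall>\<^sub>F n in sequentially. real n + real (card V) \<le> (real n * a)\<^sup>2"
    using a by real_asymp
  show ?thesis
    using ev1 ev2 ev3 ev4 eventually_gt_at_top[of 0]
  proof eventually_elim
    case (elim n)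
    define b where "b = real n * a"
    define l where "l = p * h b / b"
    have b: "0 < b" using elim a by (simp add: b_def)
    have l: "0 \<le> l" using b p h_nonneg[of b] by (simp add: l_def)
    have lb: "l * b = p * h b" using b by (simp add: l_def)
    note elim = elim[folded b_def]
    show ?case unfolding b_def[symmetric]
    proof (intro allI impI)
      fix I :: "nat set"
      assume I: "finite I" "I \<subseteq> {1..}" "card I = n"
      have [measurable]: "(\<lambda>\<omega>. \<Sum>i\<in>I. X i \<omega>) \<in> borel_measurable M"
        by (rule sum_X_rv[OF I(2)])
      have [measurable]: "X i \<in> borel_measurable M" if "i \<in> I" for i
        using that I by (auto intro: X_rv)
      note [measurable] = \<open>finite I\<close>
      let ?J = "\<lambda>i. {\<omega>\<in>space M. norm (X i \<omega>) > b}"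
      let ?D = "\<lambda>v. {\<omega>\<in>space M. v \<bullet> (\<Sum>i\<in>I. X i \<omega>) > (1 - e / 4) * b \<and> (\<forall>i\<in>I. norm (X i \<omega>) \<le> b)}"
      have sets: "?J i \<in> sets M" if "i \<in> I" for i
        using that by measurable
      have setsD: "?D v \<in> sets M" for v
        by measurable
      have UJ: "(\<Union>i\<in>I. ?J i) \<in> sets M"
        by (rule sets.finite_UN[OF I(1) sets])
      have UD: "(\<Union>v\<in>V. ?D v) \<in> sets M"
        by (rule sets.finite_UN[OF V(1) setsD])
      have "{\<omega>\<in>space M. norm (\<Sum>i\<in>I. X i \<omega>) > b} \<subseteq> (\<Union>i\<in>I. ?J i) \<union> (\<Union>v\<in>V. ?D v)"
      proof
        fix \<omega>
        assume \<omega>: "\<omega> \<in> {\<omega>\<in>space M. norm (\<Sum>i\<in>I. X i \<omega>) > b}"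
        show "\<omega> \<in> (\<Union>i\<in>I. ?J i) \<union> (\<Union>v\<in>V. ?D v)"
        proof (cases "\<exists>i\<in>I. norm (X i \<omega>) > b")
          case False
          have "(\<Sum>i\<in>I. X i \<omega>) \<noteq> 0" using \<omega> b by auto
          then obtain v where v: "v \<in> V" "(1 - e / 4) * norm (\<Sum>i\<in>I. X i \<omega>) < v \<bullet> (\<Sum>i\<in>I. X i \<omega>)"
            using V(3) by blast
          have "(1 - e / 4) * b \<le> (1 - e / 4) * norm (\<Sum>i\<in>I. X i \<omega>)"
            using \<omega> e by (intro mult_left_mono) auto
          then have "\<omega> \<in> ?D v" using v(2) \<omega> False by (auto simp: not_less)
          then show ?thesis using v(1) by blast
        qed (use \<omega> in auto)
      qed
      then have "prob {\<omega>\<in>space M. norm (\<Sum>i\<in>I. X i \<omega>) > b} \<le> prob ((\<Union>i\<in>I. ?J i) \<union> (\<Union>v\<in>V. ?D v))"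
        by (intro finite_measure_mono sets.Un UJ UD)
      also have "\<dots> \<le> prob (\<Union>i\<in>I. ?J i) + prob (\<Union>v\<in>V. ?D v)"
        by (rule measure_Un_le[OF UJ UD])
      also have "\<dots> \<le> (\<Sum>i\<in>I. prob (?J i)) + (\<Sum>v\<in>V. prob (?D v))"
        by (intro add_mono measure_UNION_le I(1) V(1) sets setsD)
      also have "\<dots> \<le> (\<Sum>i\<in>I. exp (- (1 - 3 * e / 4) * h b)) + (\<Sum>v\<in>V. exp (- (1 - 3 * e / 4) * h b))"
      proof (intro add_mono sum_mono)
        fix i assume "i \<in> I"
        then have "prob (?J i) = prob (?J 1)"
          using I(2) prob_X_eq[of i "{x. norm x > b}"] by auto
        then show "prob (?J i) \<le> exp (- (1 - 3 * e / 4) * h b)"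
          using elim(2) by simp
      next
        fix v assume v: "v \<in> V"
        have "prob (?D v) \<le> exp (- l * ((1 - e / 4) * b)) *
            (\<integral>\<omega>. exp (l * (v \<bullet> X 1 \<omega>)) * indicator {x. norm x \<le> b} (X 1 \<omega>) \<partial>M) ^ n"
          using truncated_Chernoff[OF I(1,2) _ l, of v "(1 - e / 4) * b" b] V(2)[OF v] I(3) by simp
        also have "\<dots> \<le> exp (- l * ((1 - e / 4) * b)) * exp (a * e / 4 * l) ^ n"
          using bspec[OF elim(1) v] unfolding l_def[symmetric]
          by (intro mult_left_mono power_mono) (auto intro!: integral_nonneg)
        also have "\<dots> = exp (- (1 - e / 4) * (l * b) + e / 4 * (l * b))"
          by (simp add: b_def algebra_simps flip: exp_of_nat_mult exp_add)
        also have "\<dots> = exp (- (p * (1 - e / 2)) * h b)"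
          by (simp only: lb) (simp add: algebra_simps)
        also have "\<dots> \<le> exp (- (1 - 3 * e / 4) * h b)"
        proof -
          have "1 - 3 * e / 4 \<le> p * (1 - e / 2)"
            using e by (simp add: p_def field_simps)
          then show ?thesis
            using mult_right_mono[OF _ h_nonneg[of b]] b
            by (simp only: exp_le_cancel_iff mult_minus_left neg_le_iff_le)
        qed
        finally show "prob (?D v) \<le> exp (- (1 - 3 * e / 4) * h b)" .
      qed
      also have "\<dots> = (real n + real (card V)) * exp (- (1 - 3 * e / 4) * h b)"
        using I(3) by (simp add: algebra_simps)
      also have "\<dots> \<le> b\<^sup>2 * exp (- (1 - 3 * e / 4) * h b)"
        using elim(4) by (intro mult_right_mono) auto
      also have "b\<^sup>2 = exp (2 * ln b)"
        using b exp_of_nat_mult[of 2 "ln b"] by simp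
      also have "\<dots> * exp (- (1 - 3 * e / 4) * h b) \<le> exp (- (1 - e) * h b)"
        using elim(3) by (simp add: algebra_simps flip: exp_add)
      finally show "prob {\<omega>\<in>space M. norm (\<Sum>i\<in>I. X i \<omega>) > b} \<le> exp (- (1 - e) * h b)" .
    qed
  qed
qed

text \<open>
  One big jump: the first increment exceeds \<open>n r a\<close> while the other ones add up to at most
  \<open>n (r - 1) a\<close>. The weak law of large numbers for the latter comes for free from the upper bound.
\<close>

lemma prob_walk_ge:
  assumes a: "0 < a" and q: "1 < q"
  shows "\<forall>\<^sub>F n in sequentially.
    exp (- q * h (real n * a)) \<le> \<P>(\<omega> in M. norm (\<Sum>i=1..n. X i \<omega>) > real n * a)"
proof -
  \<comment> \<open>One factor \<open>r\<close> covers the tail asymptotics and one the passage from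
    \<open>h (r * b)\<close> to \<open>r * h b\<close>; the third leaves
    \<open>r * r * (r - 1) * h b\<close> to absorb \<open>ln 2\<close>.\<close>
  define r where "r = q powr (1 / 3)"
  have r: "1 < r" "r * r * r = q"
    using q by (simp_all add: r_def gr_one_powr flip: powr_add)
  define d where "d = (r - 1) * a"
  have d: "0 < d" using r a by (simp add: d_def)
  have na: "filterlim (\<lambda>n. real n * (r * a)) at_top sequentially"
    "filterlim (\<lambda>n. real n * a) at_top sequentially"
    "filterlim (\<lambda>n. real (n - 1) * d) at_top sequentially"
    using a r(1) d by real_asymp+
  have ev1: "\<forall>\<^sub>F n in sequentially. exp (- r * h (real n * (r * a))) \<le>
      \<P>(\<omega> in M. norm (X 1 \<omega>) > real n * (r * a))"
    using na(1) by (rule eventually_compose_filterlim[OF eventually_tail_ge[OF r(1)]])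
  have half: "0 < (1 / 2 :: real)" "1 / 2 < (1 :: real)"
    by simp_all
  \<comment> \<open>Only \<open>n - 1\<close> increments remain besides the first, so the upper
    bound is used at that index.\<close>
  have "filterlim (\<lambda>n::nat. n - 1) sequentially sequentially"
    by real_asymp
  note ev2 = eventually_compose_filterlim[OF prob_sum_le[OF d half] this]
  have "\<forall>\<^sub>F b in at_top. 2 * ln 2 \<le> h b"
    using h_at_top by (auto simp: filterlim_at_top)
  note ev3 = eventually_compose_filterlim[OF this na(3)]
  have "\<forall>\<^sub>F b in at_top. ln 2 / (r * r * (r - 1)) \<le> h b"
    using h_at_top by (auto simp: filterlim_at_top)
  note ev4 = eventually_compose_filterlim[OF this na(2)]
  show ?thesis
    using ev1 ev2 ev3 ev4 eventually_gt_at_top[of 0]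
  proof eventually_elim
    case (elim n)
    define b where "b = real n * a"
    have b: "0 < b" using elim a by (simp add: b_def)
    let ?S = "\<lambda>\<omega>. \<Sum>i\<in>{2..n}. X i \<omega>"
    let ?A = "- cball (0::'v) (r * b)" and ?B = "cball (0::'v) (real n * d)"
    have split: "{1..n} = insert 1 {2..n}"
      using elim(5) by auto
    have [measurable]: "?S \<in> borel_measurable M" "(\<lambda>\<omega>. \<Sum>i=1..n. X i \<omega>) \<in> borel_measurable M"
      by (auto intro!: sum_X_rv)
    \<comment> \<open>Disjoint blocks of an independent family are independent; the first increment
      and the remaining sum are functions of the blocks \<open>{1}\<close> and
      \<open>{2..n}\<close>.\<close>
    have "indep_var borel ((\<lambda>f. f 1) \<circ> (\<lambda>\<omega>. restrict (\<lambda>i. X i \<omega>) {1}))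
        borel ((\<lambda>f. \<Sum>i\<in>{2..n}. f i) \<circ> (\<lambda>\<omega>. restrict (\<lambda>i. X i \<omega>) {2..n}))"
      by (intro indep_var_compose[OF indep_var_restrict[OF X_indep]]) auto
    also have "(\<lambda>f. f 1) \<circ> (\<lambda>\<omega>. restrict (\<lambda>i. X i \<omega>) {1}) = X 1"
      by auto
    also have "(\<lambda>f. \<Sum>i\<in>{2..n}. f i) \<circ> (\<lambda>\<omega>. restrict (\<lambda>i. X i \<omega>) {2..n}) = ?S"
      by (intro ext) (auto simp: o_def intro!: sum.cong)
    finally have ind: "indep_var borel (X 1) borel ?S" .
    have "prob {\<omega>\<in>space M. norm (?S \<omega>) > real (n - 1) * d} \<le> exp (- (1 - 1/2) * h (real (n - 1) * d))"
      using elim(2) by (auto dest!: spec[of _ "{2..n}"])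
    also have "\<dots> \<le> exp (- ln 2)"
      using elim(3) by (subst exp_le_cancel_iff) simp
    also have "\<dots> = 1 / 2"
      by (simp add: exp_minus)
    finally have "prob {\<omega>\<in>space M. norm (?S \<omega>) > real (n - 1) * d} \<le> 1 / 2" .
    moreover have "prob {\<omega>\<in>space M. \<not> norm (?S \<omega>) \<le> real n * d} \<le>
        prob {\<omega>\<in>space M. norm (?S \<omega>) > real (n - 1) * d}"
    proof (rule finite_measure_mono)
      have "real (n - 1) * d \<le> real n * d" using d by (intro mult_right_mono) auto
      then show "{\<omega>\<in>space M. \<not> norm (?S \<omega>) \<le> real n * d} \<subseteq>
          {\<omega>\<in>space M. norm (?S \<omega>) > real (n - 1) * d}" by auto
    qed measurable
    moreover have "prob {\<omega>\<in>space M. \<not> norm (?S \<omega>) \<le> real n * d} = 1 - prob {\<omega>\<in>space M. norm (?S \<omega>) \<le> real n * d}"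
      by (rule prob_neg) measurable
    ultimately have S_half: "1 / 2 \<le> \<P>(\<omega> in M. ?S \<omega> \<in> ?B)"
      by simp
    have "h (r * b) \<le> r * h b"
      using h_ratio_antimono[of b "r * b"] b r(1) by (simp add: field_simps)
    then have "r * h (r * b) \<le> r * (r * h b)"
      using r(1) by (intro mult_left_mono) auto
    moreover have "ln 2 \<le> r * r * (r - 1) * h b"
      using elim(4) r(1) by (simp add: b_def field_simps)
    ultimately have "r * h (r * b) + ln 2 \<le> q * h b"
      by (simp add: algebra_simps flip: r(2))
    then have "exp (- q * h b) \<le> exp (- r * h (r * b) + - ln 2)"
      by (subst exp_le_cancel_iff) simp
    also have "\<dots> = exp (- r * h (r * b)) * (1 / 2)"
      by (simp only: exp_add exp_minus) simp
    also have "\<dots> \<le> \<P>(\<omega> in M. X 1 \<omega> \<in> ?A) * \<P>(\<omega> in M. ?S \<omega> \<in> ?B)"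
      using elim(1) S_half by (intro mult_mono) (auto simp: b_def algebra_simps not_le)
    also have "\<dots> = \<P>(\<omega> in M. X 1 \<omega> \<in> ?A \<and> ?S \<omega> \<in> ?B)"
      by (rule prob_indep_random_variable[OF ind, symmetric]) auto
    also have "\<dots> \<le> \<P>(\<omega> in M. norm (\<Sum>i=1..n. X i \<omega>) > b)"
    proof (rule finite_measure_mono)
      show "{\<omega>\<in>space M. X 1 \<omega> \<in> ?A \<and> ?S \<omega> \<in> ?B} \<subseteq> {\<omega>\<in>space M. norm (\<Sum>i=1..n. X i \<omega>) > b}"
      proof safe
        fix \<omega>
        \<comment> \<open>Because \<open>real n * d = r * b - b\<close>, the reverse triangle
          inequality leaves a norm above \<open>b\<close>.\<close>
        assume "X 1 \<omega> \<notin> cball 0 (r * b)" "?S \<omega> \<in> ?B"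
        then have "r * b < norm (X 1 \<omega>)" "norm (?S \<omega>) \<le> r * b - b"
          by (auto simp: d_def b_def algebra_simps)
        then have "b < norm (X 1 \<omega>) - norm (?S \<omega>)" by simp
        also have "\<dots> \<le> norm (X 1 \<omega> + ?S \<omega>)" by (rule norm_diff_ineq)
        finally show "b < norm (\<Sum>i=1..n. X i \<omega>)"
          unfolding split by (subst sum.insert) auto
      qed
    qed measurable
    finally show ?case by (simp add: b_def)
  qed
qed

section \<open>Combination of the two bounds\<close>

theorem ln_prob_walk_tendsto:
  assumes a: "0 < a"
  shows "(\<lambda>n. ln (\<P>(\<omega> in M. norm (\<Sum>i=1..n. X i \<omega>) > real n * a)) / h (real n * a)) \<longlonglongrightarrow> - 1"
proof (rule tendstoI)
  fix e :: real
  assume "0 < e"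
  \<comment> \<open>The half of \<open>e\<close> gives a strict inequality at the end; the cap
    \<open>1 / 2\<close> keeps \<open>d < 1\<close>, as the upper bound requires.\<close>
  define d where "d = min (e / 2) (1 / 2)"
  have d: "0 < d" "d < 1" "d < e" using \<open>0 < e\<close> by (auto simp: d_def)
  have "filterlim (\<lambda>n. real n * a) at_top sequentially"
    using a by real_asymp
  note pos = eventually_compose_filterlim[OF eventually_h_pos this]
  have "\<forall>\<^sub>F n in sequentially. exp (- (1 + d) * h (real n * a)) \<le>
      \<P>(\<omega> in M. norm (\<Sum>i=1..n. X i \<omega>) > real n * a)"
    using d by (intro prob_walk_ge a) auto
  with prob_sum_le[OF a d(1,2)] pos
  show "\<forall>\<^sub>F n in sequentially.
      dist (ln (\<P>(\<omega> in M. norm (\<Sum>i=1..n. X i \<omega>) > real n * a)) / h (real n * a)) (- 1) < e"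
  proof eventually_elim
    case (elim n)
    let ?h = "h (real n * a)" and ?P = "\<P>(\<omega> in M. norm (\<Sum>i=1..n. X i \<omega>) > real n * a)"
    have up: "?P \<le> exp (- (1 - d) * ?h)"
      using elim(1) by (auto dest!: spec[of _ "{1..n}"])
    have P: "0 < ?P"
      using elim(3) by (rule less_le_trans[OF exp_gt_zero])
    have "- (1 + d) * ?h \<le> ln ?P"
      using P elim(3) by (simp only: ln_ge_iff)
    moreover have "ln ?P \<le> - (1 - d) * ?h"
      using P up ln_le_cancel_iff[OF P exp_gt_zero] by (simp only: ln_exp)
    ultimately have "\<bar>ln ?P / ?h + 1\<bar> \<le> d"
      using elim(2) by (simp add: abs_le_iff field_simps)
    then show ?case using d by (simp add: dist_real_def)
  qed
qed

end

section \<open>Reduction to a rate vanishing at 0\<close>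

theorem theorem2p1:
  fixes M :: "'w measure"
    and R :: "'w \<Rightarrow> real"
    and U :: "'w \<Rightarrow> real ^ 'd"
    and X :: "nat \<Rightarrow> 'w \<Rightarrow> real ^ 'd"
    and h :: "real \<Rightarrow> real"
    and a :: real
  assumes M: "prob_space M"
    and a: "a > 0"
    and R_rv: "R \<in> borel_measurable M"
    and R_nonneg: "\<And>\<omega>. \<omega> \<in> space M \<Longrightarrow> R \<omega> \<ge> 0"
    and h_mono: "mono_on {0..} h"
    and h_concave: "concave_on {0..} h"
    and h_sublinear: "h \<in> o[at_top](\<lambda>x. x)"
    and h_superlog: "(\<lambda>x. ln x) \<in> o[at_top](h)"
    and R_tail: "(\<lambda>x. - ln (\<P>(\<omega> in M. R \<omega> > x))) \<sim>[at_top] h"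
    and U_rv: "U \<in> borel_measurable M"
    and U_sphere: "\<And>\<omega>. \<omega> \<in> space M \<Longrightarrow> U \<omega> \<in> sphere 0 1"
    and U_pos: "\<And>S. S \<in> sets borel \<Longrightarrow> S \<subseteq> sphere 0 1 \<Longrightarrow> emeasure sphere_surface S > 0 \<Longrightarrow>
                  \<P>(\<omega> in M. U \<omega> \<in> S) > 0"
    and U_indep_limit: "\<And>S. S \<in> sets borel \<Longrightarrow> S \<subseteq> sphere 0 1 \<Longrightarrow> emeasure sphere_surface S > 0 \<Longrightarrow>
                  ((\<lambda>x. \<P>(\<omega> in M. U \<omega> \<in> S \<bar> R \<omega> > x)) \<longlongrightarrow> \<P>(\<omega> in M. U \<omega> \<in> S)) at_top"
    and mean_zero: "has_bochner_integral M (\<lambda>\<omega>. R \<omega> *\<^sub>R U \<omega>) 0"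
    and X_indep: "prob_space.indep_vars M (\<lambda>_. borel) X {1..}"
    and X_distr: "\<And>i. i \<ge> 1 \<Longrightarrow> distr M borel (X i) = distr M borel (\<lambda>\<omega>. R \<omega> *\<^sub>R U \<omega>)"
  shows "(\<lambda>n. ln (\<P>(\<omega> in M. norm (\<Sum>i=1..n. X i \<omega>) > real n * a)) / h (real n * a))
           \<longlonglongrightarrow> - 1"
proof -
  define g where "g x = h x - h 0" for x
  interpret prob_space M by (rule M)
  have ln_h: "\<forall>\<^sub>F x in at_top. ln x \<le> norm (h x)"
    using landau_o.smallD[OF h_superlog zero_less_one] by eventually_elim simp
  have h_lim: "filterlim h at_top at_top"
  proof (rule filterlim_at_top_mono[OF ln_at_top])
    show "\<forall>\<^sub>F x in at_top. ln x \<le> h x"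
      \<comment> \<open>The little-o relation controls only the absolute value of \<open>h\<close>,
        which may start negative. A negative \<open>h x\<close> would give
        \<open>ln x \<le> - h x \<le> - h 0\<close>, impossible once
        \<open>ln x > - h 0\<close>.\<close>
      using ln_h filterlim_at_top_dense[THEN iffD1, OF ln_at_top, rule_format, of "- h 0"]
        eventually_ge_at_top[of 0]
    proof eventually_elim
      case (elim x)
      have "h 0 \<le> h x" using h_mono elim(3) by (auto simp: mono_on_def)
      then show ?case using elim by (auto simp: abs_if split: if_splits)
    qed
  qed
  have const: "(\<lambda>x. c) \<in> o[at_top](h)" for c :: real
    using h_lim by (intro smalloI_tendsto tendsto_divide_0[OF tendsto_const])
      (auto intro: filterlim_at_top_imp_at_infinity eventually_mono[OF
        filterlim_at_top_dense[THEN iffD1, OF h_lim, rule_format, of 0]])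
  \<comment> \<open>The shift by the constant \<open>h 0\<close> is negligible because
    \<open>h\<close> tends to infinity, so growth conditions, tail asymptotics and the final
    normalisation all transfer between \<open>g\<close> and \<open>h\<close>.\<close>
  have gh: "g \<sim>[at_top] h"
    by (rule smallo_imp_asymp_equiv) (use const[of "- h 0"] in \<open>simp add: g_def\<close>)
  interpret heavy_tailed_walk M g X
  proof unfold_locales
    show "g 0 = 0" by (simp add: g_def)
    show "mono_on {0..} g" using h_mono by (auto simp: mono_on_def g_def)
    show "concave_on {0..} g"
      unfolding g_def by (intro concave_on_diff h_concave) (simp add: convex_on_const)
    show "g \<in> o[at_top](\<lambda>x. x)"
      using landau_o.small.in_cong_bigtheta[OF asymp_equiv_imp_bigtheta[OF gh]] h_sublinear by blast
    show "(\<lambda>x. ln x) \<in> o[at_top](g)"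
      using landau_o.small.cong_bigtheta[OF asymp_equiv_imp_bigtheta[OF gh]] h_superlog by blast
    show X1: "X 1 \<in> borel_measurable M"
      using X_indep by (auto simp: indep_vars_def)
    have RU [measurable]: "(\<lambda>\<omega>. R \<omega> *\<^sub>R U \<omega>) \<in> borel_measurable M"
      using R_rv U_rv by measurable
    have "has_bochner_integral (distr M borel (\<lambda>\<omega>. R \<omega> *\<^sub>R U \<omega>)) (\<lambda>x. x) 0"
      using mean_zero by (intro has_bochner_integral_distr) auto
    then have "has_bochner_integral (distr M borel (X 1)) (\<lambda>x. x) 0"
      by (simp only: X_distr[OF order_refl])
    then show "has_bochner_integral M (X 1) 0"
      using X1 by (simp add: has_bochner_integral_iff integrable_distr_eq integral_distr)
    \<comment> \<open>The direction has norm 1 and the radius is nonnegative, so the norm of an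
      increment has the tail of \<open>R\<close>.\<close>
    have "\<P>(\<omega> in M. norm (X 1 \<omega>) > x) = \<P>(\<omega> in M. R \<omega> > x)" for x
    proof -
      have "\<P>(\<omega> in M. norm (X 1 \<omega>) > x) = measure (distr M borel (X 1)) {y. norm y > x}"
        using X1 by (subst measure_distr) (auto intro!: arg_cong[where f = prob])
      also have "\<dots> = \<P>(\<omega> in M. norm (R \<omega> *\<^sub>R U \<omega>) > x)"
        using RU by (subst X_distr, simp, subst measure_distr) (auto intro!: arg_cong[where f = prob])
      also have "\<dots> = \<P>(\<omega> in M. R \<omega> > x)"
        using R_nonneg U_sphere by (auto intro!: arg_cong[where f = prob] simp: abs_of_nonneg)
      finally show ?thesis .
    qed
    then show "(\<lambda>x. - ln (\<P>(\<omega> in M. norm (X 1 \<omega>) > x))) \<sim>[at_top] g"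
      using asymp_equiv_trans[OF R_tail asymp_equiv_symI[OF gh]] by simp
    show "indep_vars (\<lambda>_. borel) X {1..}" by (rule X_indep)
    show "distr M borel (X i) = distr M borel (X 1)" if "1 \<le> i" for i
      using X_distr[OF that] X_distr[of 1] by simp
  qed
  have "filterlim (\<lambda>n. real n * a) at_top sequentially"
    using a by real_asymp
  then have "(\<lambda>n. g (real n * a)) \<sim>[sequentially] (\<lambda>n. h (real n * a))"
    by (rule asymp_equiv_compose'[OF gh])
  then have "(\<lambda>n. ln (\<P>(\<omega> in M. norm (\<Sum>i=1..n. X i \<omega>) > real n * a)) / g (real n * a))
      \<sim>[sequentially] (\<lambda>n. ln (\<P>(\<omega> in M. norm (\<Sum>i=1..n. X i \<omega>) > real n * a)) / h (real n * a))"
    by (intro asymp_equiv_intros)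
  then show ?thesis
    by (rule asymp_equiv_tendsto_transfer[OF _ ln_prob_walk_tendsto[OF a]])
qed

end
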